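(* Let $p$ be an odd prime, $r\ge1$, and $0\le i<k<2r$ such that $h(x)=x^{p^i+p^k}$ is planar on $\mathbb{F}_{p^{2r}}$, and let $f_2(x)=h(x)+h(x)^{p^r}+x^2-x^{2p^r}$. Then $f_2$ is not CCZ-equivalent to any generalized Budaghyan–Helleseth function on $\mathbb{F}_{p^{2r}}$.
   Context: A generalized Budaghyan–Helleseth function on $\mathbb{F}_{p^{2r}}$ is a function $B(x)=x^{p^r+1}+\omega\beta x^{p^s+1}+\omega\beta^{p^r}x^{(p^s+1)p^r}$, where $s$ is an integer, $\omega,\beta\in\mathbb{F}_{p^{2r}}$ with $\omega+\omega^{p^r}=0$, $\beta^{p^r-1}$ does not lie in the subgroup of $\mathbb{F}_{p^{2r}}^*$ of order $(p^r+1)/\gcd(p^r+1,p^s+1)$, and $x^{p^s}\ne -x$ for all $x\in\mathbb{F}_{p^{2r}}^*$. A function $f$ is planar if $x\mapsto f(x+a)-f(x)$ is a bijection for every $a\ne0$. Functions $F,G$ on $\mathbb{F}_q$ are CCZ-equivalent if an affine permutation of $\mathbb{F}_q\times\mathbb{F}_q$ (over the prime field) maps the graph of $F$ onto the graph of $G$. *)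

theory Defs
  imports
    "HOL-Algebra.Algebraic_Closure_Type"
    "HOL-Algebra.Multiplicative_Group"
    "HOL-Library.Cardinality"
    "HOL-Library.Product_Plus"
    "HOL-Computational_Algebra.Primes"
begin

definition planar :: "('a::{field,finite} \<Rightarrow> 'a) \<Rightarrow> bool" where
  "planar f \<longleftrightarrow> (\<forall>a. a \<noteq> 0 \<longrightarrow> bij (\<lambda>x. f (x + a) - f x))"

definition graph_of :: "('a \<Rightarrow> 'b) \<Rightarrow> ('a \<times> 'b) set" where
  "graph_of F = {(x, F x) |x. True}"

text \<open>The prime subfield of a finite field is the range of \<^term>\<open>of_int\<close>.\<close>

definition prime_field_linear :: "('a::{field,finite} \<times> 'a \<Rightarrow> 'a \<times> 'a) \<Rightarrow> bool" where
  "prime_field_linear L \<longleftrightarrow>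
     (\<forall>u v. L (u + v) = L u + L v) \<and>
     (\<forall>c\<in>range (of_int :: int \<Rightarrow> 'a). \<forall>x y.
        L (c * x, c * y) = (c * fst (L (x, y)), c * snd (L (x, y))))"

definition affine_perm :: "('a::{field,finite} \<times> 'a \<Rightarrow> 'a \<times> 'a) \<Rightarrow> bool" where
  "affine_perm A \<longleftrightarrow> bij A \<and> (\<exists>L b. prime_field_linear L \<and> A = (\<lambda>v. L v + b))"

definition CCZ_equivalent :: "('a::{field,finite} \<Rightarrow> 'a) \<Rightarrow> ('a \<Rightarrow> 'a) \<Rightarrow> bool" where
  "CCZ_equivalent F G \<longleftrightarrow> (\<exists>A. affine_perm A \<and> A ` graph_of F = graph_of G)"

text \<open>
  The multiplicative group of a finite field is cyclic, so for each divisor \<open>n\<close> of its order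
  there is exactly one subgroup of order \<open>n\<close>; the quantifier over \<open>H\<close> below therefore ranges over
  that single subgroup. On a field with \<open>p ^ (2 * r)\<close> elements, both the map \<open>B\<close> and the conditions
  depend on \<open>s\<close> only modulo \<open>2 * r\<close>, so nothing is lost by taking \<open>s\<close> to be a natural number.
\<close>

definition generalized_BH :: "nat \<Rightarrow> nat \<Rightarrow> ('a::{field,finite} \<Rightarrow> 'a) \<Rightarrow> bool" where
  "generalized_BH p r B \<longleftrightarrow>
     (\<exists>(s::nat) (\<omega>::'a) (\<beta>::'a).
        \<omega> + \<omega> ^ (p ^ r) = 0 \<and>
        (\<forall>H. subgroup H (mult_of (ring_of_type_algebra :: 'a ring)) \<and>
             card H = (p ^ r + 1) div gcd (p ^ r + 1) (p ^ s + 1) \<longrightarrow>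
             \<beta> ^ (p ^ r - 1) \<notin> H) \<and>
        (\<forall>x::'a. x \<noteq> 0 \<longrightarrow> x ^ (p ^ s) \<noteq> - x) \<and>
        B = (\<lambda>x. x ^ (p ^ r + 1) + \<omega> * \<beta> * x ^ (p ^ s + 1)
                  + \<omega> * \<beta> ^ (p ^ r) * x ^ ((p ^ s + 1) * p ^ r)))"

end

theory Submission
  imports Defs
begin

text \<open>
  Write \<open>n = 2 * r\<close> and \<open>\<bar>x\<bar>\<close> for \<open>x ^ p ^ r\<close>. The polar form of \<open>f\<^sub>2\<close> is nondegenerate, which forces
  an affine equivalence between the graphs of \<open>f\<^sub>2\<close> and \<open>B\<close> to be of the form
  \<open>(x, y) \<mapsto> (M x + b, K x + N y + c)\<close>, so that \<open>N\<close> carries the polar form of \<open>f\<^sub>2\<close> to the polar form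
  of \<open>B\<close> evaluated at \<open>M x, M y\<close>. Adding the conjugate equation removes the terms of \<open>B\<close> involving
  \<open>\<omega>\<close> and leaves \<open>2 * (M x * \<bar>M y\<bar> + \<bar>M x\<bar> * M y) = W (polar f\<^sub>2 x y)\<close> with \<open>W\<close> additive.
  Now expand \<open>M x = (\<Sum>j<n. m j * x ^ p ^ j)\<close> with indices modulo \<open>n\<close>. As \<open>k - i \<noteq> r\<close>, the right-hand
  side has no monomial \<open>x ^ p ^ j * y ^ p ^ (j + r)\<close>, while its coefficients at \<open>(x * y) ^ p ^ j\<close>
  and \<open>(x * y) ^ p ^ (j + r)\<close> are opposite. Hence \<open>a = m j\<close> and \<open>b = m (j + r)\<close> satisfy
  \<open>a * \<bar>a\<bar> = - b * \<bar>b\<bar>\<close> and \<open>a * \<bar>b\<bar> = - \<bar>a\<bar> * b\<close>, which is only possible for \<open>a = 0\<close>. So \<open>M = 0\<close>,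
  contradicting bijectivity.
\<close>

section \<open>Index arithmetic modulo \<open>n\<close>\<close>

lemma sum_periodic_shift:
  fixes f :: "nat \<Rightarrow> 'b::ab_group_add"
  assumes "\<And>j. f (j + n) = f j"
  shows "(\<Sum>j<n. f (j + c)) = (\<Sum>j<n. f j)"
proof (induction c)
  case (Suc c)
  have "(\<Sum>j<n. f (j + Suc c)) + f c = (\<Sum>j<n. f (j + c)) + f (n + c)"
    using sum.lessThan_Suc_shift[of "\<lambda>j. f (j + c)" n] by (simp add: add.commute)
  moreover have "f (n + c) = f c"
    using assms[of c] by (simp add: add.commute)
  ultimately show ?case
    using Suc by simp
qed simp

text \<open>Congruent numbers whose distance is below \<open>2 * n\<close> have distance 0 or
  \<open>n\<close>; both are excluded. This keeps the exponents of different monomials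
  apart.\<close>

lemma mod_add_neq:
  fixes j s t n :: nat
  assumes "s \<noteq> t" "s < t + 2 * n" "t < s + 2 * n" "s \<noteq> t + n" "t \<noteq> s + n"
  shows "(j + s) mod n \<noteq> (j + t) mod n"
proof
  have *: False if "(j + s) mod n = (j + t) mod n" "t < s" "s < t + 2 * n" "s \<noteq> t + n" for s t :: nat
  proof -
    have "n dvd (j + s) - (j + t)"
      using that by (subst mod_eq_dvd_iff_nat[symmetric]) auto
    then obtain c where c: "s - t = n * c"
      by auto
    then have "n * c < n * 2"
      using that by linarith
    then have "c = 0 \<or> c = 1"
      by auto
    then show False
      using c that by auto
  qed
  assume "(j + s) mod n = (j + t) mod n"
  then show False
    using *[of s t] *[of t s] assms by (metis linorder_neqE_nat)
qed

section \<open>Frobenius powers in a field with \<open>p ^ n\<close> elements\<close>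

locale finite_field_order =
  fixes p n :: nat and F :: "'a::{field,finite} itself"
  assumes prime_p: "prime p" and CARD_eq: "CARD('a) = p ^ n"
begin

lemma CHAR_eq: "CHAR('a) = p"
proof -
  have "prime CHAR('a)"
    by (simp add: finite_imp_CHAR_pos prime_CHAR_semidom)
  moreover have "CHAR('a) dvd p ^ n"
  proof -
    \<comment> \<open>Translation by 1 permutes the field.\<close>
    have "(\<Sum>x\<in>UNIV. x) = (\<Sum>x\<in>UNIV. x + 1 :: 'a)"
      by (rule sum.reindex_bij_witness[of _ "\<lambda>x. x + 1" "\<lambda>x. x - 1"]) auto
    then have "of_nat CARD('a) = (0::'a)"
      by (simp add: sum.distrib)
    then show ?thesis
      unfolding of_nat_eq_0_iff_char_dvd CARD_eq .
  qed
  ultimately show ?thesis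
    using prime_p by (meson prime_dvd_power primes_dvd_imp_eq)
qed

lemma power_order: "(x::'a) ^ p ^ n = x"
proof (cases "x = 0")
  case False
  have "(\<Prod>y\<in>UNIV - {0}. y) = (\<Prod>y\<in>UNIV - {0}. x * y)"
    by (rule prod.reindex_bij_witness[of _ "\<lambda>y. x * y" "\<lambda>y. y / x"]) (use False in auto)
  also have "\<dots> = x ^ (CARD('a) - 1) * (\<Prod>y\<in>UNIV - {0}. y)"
    by (simp add: prod.distrib card_Diff_singleton)
  finally have "x ^ (CARD('a) - 1) = 1"
    by simp
  then have "x ^ Suc (CARD('a) - 1) = x"
    unfolding power_Suc by simp
  then show ?thesis
    using CARD_eq prime_p by (simp add: prime_gt_0_nat)
qed (use prime_p in \<open>simp add: prime_gt_0_nat\<close>)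

definition frob :: "nat \<Rightarrow> 'a \<Rightarrow> 'a" where
  "frob j x = x ^ p ^ j"

lemma frob_add [simp]: "frob j (x + y) = frob j x + frob j y"
  using freshmans_dream'[of "p ^ j" j x y] CHAR_eq prime_p by (simp add: frob_def)

lemma frob_0_left [simp]: "frob 0 x = x"
  by (simp add: frob_def)

lemma frob_0 [simp]: "frob j 0 = 0"
  using prime_p by (simp add: frob_def prime_gt_0_nat)

lemma frob_1 [simp]: "frob j 1 = 1"
  by (simp add: frob_def)

lemma frob_mult [simp]: "frob j (x * y) = frob j x * frob j y"
  by (simp add: frob_def power_mult_distrib)

lemma frob_minus [simp]: "frob j (- x) = - frob j x"
  using frob_add[of j x "- x"] by (simp add: eq_neg_iff_add_eq_0 add.commute)

lemma frob_diff [simp]: "frob j (x - y) = frob j x - frob j y"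
  using frob_add[of j x "- y"] by simp

lemma frob_2 [simp]: "frob j 2 = 2"
  using frob_add[of j 1 1] by simp

lemma frob_eq_0_iff [simp]: "frob j x = 0 \<longleftrightarrow> x = 0"
  using prime_p by (simp add: frob_def prime_gt_0_nat)

lemma frob_inject [simp]: "frob j x = frob j y \<longleftrightarrow> x = y"
  using frob_eq_0_iff[of j "x - y"] by simp

lemma frob_sum [simp]: "frob j (sum f A) = (\<Sum>a\<in>A. frob j (f a))"
  by (induction A rule: infinite_finite_induct) auto

lemma frob_frob [simp]: "frob j (frob l x) = frob (l + j) x"
  by (simp add: frob_def power_add flip: power_mult)

lemma frob_order [simp]: "frob n x = x"
  by (simp add: frob_def power_order)

lemma frob_periodic [simp]: "frob (j + n) x = frob j x"
  using frob_frob[of j n "x"] frob_frob[of n j x] by (simp only: frob_order add.commute)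

lemma frob_mod: "frob (j mod n) x = frob j x"
proof -
  have "frob (j mod n + n * c) x = frob (j mod n) x" for c
  proof (induction c)
    case (Suc c)
    then show ?case
      using frob_periodic[of "j mod n + n * c" x] by (simp add: algebra_simps)
  qed simp
  from this[of "j div n"] show ?thesis
    by simp
qed

section \<open>Additive maps as linearized polynomials\<close>

text \<open>The difference is a polynomial of degree at most \<open>p ^ (n - 1)\<close> vanishing at
  all \<open>p ^ n\<close> field elements, hence zero; the exponents \<open>p ^ j\<close> are
  distinct, so its coefficients can be read off.\<close>

lemma frob_coeff_unique:
  assumes eq: "\<And>x. (\<Sum>j<n. a j * frob j x) = (\<Sum>j<n. b j * frob j x)" and "j < n"
  shows "a j = b j"
proof -
  define P where "P = (\<Sum>j<n. monom (a j - b j) (p ^ j))"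
  have p1: "p > 1"
    using prime_p by (rule prime_gt_1_nat)
  have "degree P \<le> p ^ (n - 1)"
    unfolding P_def using p1
    by (intro degree_sum_le order.trans[OF degree_monom_le] power_increasing) auto
  also have "\<dots> < CARD('a)"
    using p1 \<open>j < n\<close> by (simp add: CARD_eq)
  finally have "degree P < CARD('a)" .
  moreover have "poly P x = 0" for x
    using eq[of x] by (simp add: P_def poly_sum poly_monom frob_def algebra_simps sum_subtractf)
  ultimately have "P = 0"
    by (intro poly_eqI_degree[where A = UNIV]) auto
  then have "0 = coeff P (p ^ j)"
    by simp
  also have "\<dots> = (\<Sum>l<n. if l = j then a l - b l else 0)"
    unfolding P_def coeff_sum using p1 by (intro sum.cong) (auto simp: power_inject_exp)
  also have "\<dots> = a j - b j"
    using \<open>j < n\<close> by simp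
  finally show ?thesis
    by simp
qed

lemma of_nat_inj_on: "inj_on (of_nat :: nat \<Rightarrow> 'a) {..<p}"
proof (rule linorder_inj_onI)
  fix x y :: nat assume "x < y" "x \<in> {..<p}" "y \<in> {..<p}"
  then have "of_nat (y - x) \<noteq> (0::'a)"
    unfolding of_nat_eq_0_iff_char_dvd CHAR_eq by (simp add: nat_dvd_not_less)
  with \<open>x < y\<close> show "of_nat x \<noteq> (of_nat y :: 'a)"
    by (simp add: of_nat_diff)
qed auto

lemma additive_of_nat_mult:
  fixes M :: "'a \<Rightarrow> 'a"
  assumes "additive M"
  shows "M (of_nat c * x) = of_nat c * M x"
  using assms by (induction c) (simp_all add: additive.zero additive.add algebra_simps)

text \<open>A minimal set \<open>S\<close> determining additive maps is linearly independent over the prime field.\<close>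

lemma ex_small_determining_set:
  "\<exists>S::'a set. card S \<le> n \<and>
     (\<forall>M. additive (M :: 'a \<Rightarrow> 'a) \<longrightarrow> (\<forall>b\<in>S. M b = 0) \<longrightarrow> (\<forall>x. M x = 0))"
proof -
  define D where
    "D S \<longleftrightarrow> (\<forall>M. additive (M :: 'a \<Rightarrow> 'a) \<longrightarrow> (\<forall>b\<in>S. M b = 0) \<longrightarrow> (\<forall>x. M x = 0))" for S
  have "D UNIV"
    by (auto simp: D_def)
  then obtain S where S: "D S" and min: "\<And>T. D T \<Longrightarrow> card S \<le> card T"
    using ex_has_least_nat[of D UNIV card] by blast
  \<comment> \<open>By minimality, once \<open>b\<close> is dropped from \<open>S\<close> some
    additive map kills the rest but not \<open>b\<close>. These maps act as a dual basis.\<close>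
  have "\<exists>M :: 'a \<Rightarrow> 'a. additive M \<and> (\<forall>c\<in>S - {b}. M c = 0) \<and> M b \<noteq> 0" if "b \<in> S" for b
  proof -
    have "card (S - {b}) < card S"
      using that by (intro card_Diff1_less) auto
    then have "\<not> D (S - {b})"
      using min by (meson not_le)
    then obtain M :: "'a \<Rightarrow> 'a" and x where M: "additive M" "\<forall>c\<in>S - {b}. M c = 0" "M x \<noteq> 0"
      unfolding D_def by blast
    then have "M b \<noteq> 0"
      using S unfolding D_def by blast
    with M show ?thesis
      by blast
  qed
  then obtain M :: "'a \<Rightarrow> 'a \<Rightarrow> 'a" where
    "\<forall>b\<in>S. additive (M b) \<and> (\<forall>c\<in>S - {b}. M b c = 0) \<and> M b b \<noteq> 0"
    by metis
  then have M: "\<And>b. b \<in> S \<Longrightarrow> additive (M b)"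
      "\<And>b c. b \<in> S \<Longrightarrow> c \<in> S \<Longrightarrow> c \<noteq> b \<Longrightarrow> M b c = 0" "\<And>b. b \<in> S \<Longrightarrow> M b b \<noteq> 0"
    by blast+
  \<comment> \<open>Applying \<open>M b\<close> recovers the coefficient at \<open>b\<close>, so the
    \<open>p ^ card S\<close> combinations with coefficients below \<open>p\<close> are distinct
    field elements.\<close>
  define comb where "comb c = (\<Sum>b\<in>S. of_nat (c b) * b)" for c :: "'a \<Rightarrow> nat"
  have M_comb: "M b (comb c) = of_nat (c b) * M b b" if "b \<in> S" for b c
  proof -
    have "M b (comb c) = (\<Sum>a\<in>S. of_nat (c a) * M b a)"
      by (simp add: comb_def additive.sum[OF M(1)[OF that]] additive_of_nat_mult[OF M(1)[OF that]])
    also have "\<dots> = (\<Sum>a\<in>S. if a = b then of_nat (c b) * M b b else 0)"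
      by (intro sum.cong) (use M(2) that in auto)
    finally show ?thesis
      using that by simp
  qed
  have "inj_on comb (S \<rightarrow>\<^sub>E {..<p})"
  proof (intro inj_onI)
    fix c d assume cd: "c \<in> S \<rightarrow>\<^sub>E {..<p}" "d \<in> S \<rightarrow>\<^sub>E {..<p}" and "comb c = comb d"
    show "c = d"
    proof (rule PiE_ext[OF cd])
      fix b assume b: "b \<in> S"
      then have "(of_nat (c b) :: 'a) = of_nat (d b)"
        using M_comb[OF b, of c] M_comb[OF b, of d] M(3)[OF b] \<open>comb c = comb d\<close> by simp
      then show "c b = d b"
        using inj_onD[OF of_nat_inj_on, of "c b" "d b"] cd b by auto
    qed
  qed
  then have "card (S \<rightarrow>\<^sub>E {..<p}) \<le> CARD('a)"
    by (intro card_inj_on_le) auto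
  then have "p ^ card S \<le> p ^ n"
    by (simp add: card_PiE CARD_eq)
  then have "card S \<le> n"
    using prime_p prime_gt_1_nat power_le_imp_le_exp by blast
  with S show ?thesis
    unfolding D_def by blast
qed

text \<open>The sums on the right are \<open>q ^ n\<close> distinct additive maps, where \<open>q = p ^ n\<close>, and by the
  preceding lemma there are no more.\<close>

lemma additive_eq_frob_sum:
  fixes M :: "'a \<Rightarrow> 'a"
  assumes "additive M"
  obtains m where "\<And>j. m (j + n) = m j" "\<And>x. M x = (\<Sum>j<n. m j * frob j x)"
proof -
  define Add where "Add = {M :: 'a \<Rightarrow> 'a. additive M}"
  define lin where "lin c x = (\<Sum>j<n. c j * frob j x)" for c x
  obtain S :: "'a set" where S: "card S \<le> n"
      "\<And>M :: 'a \<Rightarrow> 'a. additive M \<Longrightarrow> (\<And>b. b \<in> S \<Longrightarrow> M b = 0) \<Longrightarrow> (\<forall>x. M x = 0)"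
    using ex_small_determining_set by blast
  \<comment> \<open>An additive map is determined by its values on \<open>S\<close>, which bounds
    the number of such maps.\<close>
  have "inj_on (\<lambda>M. restrict M S) Add"
  proof (intro inj_onI)
    fix M N assume MN: "M \<in> Add" "N \<in> Add" and eq: "restrict M S = restrict N S"
    have "additive (\<lambda>x. M x - N x)"
      using MN by (auto simp: Add_def additive_def)
    moreover have "M b - N b = 0" if "b \<in> S" for b
      using fun_cong[OF eq, of b] that by simp
    ultimately have "\<forall>x. M x - N x = 0"
      using S(2)[of "\<lambda>x. M x - N x"] by blast
    then show "M = N"
      by auto
  qed
  then have "card Add \<le> card (S \<rightarrow>\<^sub>E (UNIV :: 'a set))"
    by (intro card_inj_on_le) auto
  also have "\<dots> \<le> CARD('a) ^ n"
    using S(1) by (simp add: card_PiE power_increasing)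
  also have "\<dots> = card (lin ` ({..<n} \<rightarrow>\<^sub>E UNIV))"
  proof (subst card_image)
    show "inj_on lin ({..<n} \<rightarrow>\<^sub>E UNIV)"
    proof (intro inj_onI)
      fix c d assume cd: "c \<in> {..<n} \<rightarrow>\<^sub>E UNIV" "d \<in> {..<n} \<rightarrow>\<^sub>E UNIV" and "lin c = lin d"
      then have "lin c x = lin d x" for x
        by simp
      then have "c j = d j" if "j < n" for j
        using frob_coeff_unique[of c d j] that by (simp add: lin_def)
      then show "c = d"
        by (intro PiE_ext[OF cd]) auto
    qed
  qed (simp add: card_PiE)
  finally have "card Add \<le> card (lin ` ({..<n} \<rightarrow>\<^sub>E UNIV))" .
  moreover have "additive (lin c)" for c
    by (rule additive.intro) (simp add: lin_def distrib_left sum.distrib)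
  then have "lin ` ({..<n} \<rightarrow>\<^sub>E UNIV) \<subseteq> Add"
    by (auto simp: Add_def)
  ultimately have "lin ` ({..<n} \<rightarrow>\<^sub>E UNIV) = Add"
    by (intro card_seteq) simp_all
  then have "M \<in> lin ` ({..<n} \<rightarrow>\<^sub>E UNIV)"
    using assms by (simp add: Add_def)
  then obtain c where c: "M = lin c"
    by blast
  \<comment> \<open>The coefficients are extended periodically so that shifted indices such as
    \<open>j + r\<close> may exceed \<open>n\<close>.\<close>
  show ?thesis
  proof
    show "c ((j + n) mod n) = c (j mod n)" for j
      by simp
    show "M x = (\<Sum>j<n. c (j mod n) * frob j x)" for x
      by (simp add: c lin_def)
  qed
qed

section \<open>Planarity and nondegeneracy of polar forms\<close>

lemma two_neq_0:
  assumes "odd p"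
  shows "(2::'a) \<noteq> 0"
proof -
  have "\<not> CHAR('a) dvd 2"
    using assms prime_p primes_dvd_imp_eq[OF prime_p two_is_prime_nat] by (auto simp: CHAR_eq)
  then show ?thesis
    using of_nat_eq_0_iff_char_dvd[where 'a = 'a, of 2] by simp
qed

text \<open>A zero would give the difference map in direction \<open>y\<close> the same value at
  \<open>x\<close> and at 0, against injectivity.\<close>

lemma planar_frob_prod_nondegenerate:
  assumes "planar (\<lambda>x. frob i x * frob k x)" and "x \<noteq> 0" "y \<noteq> 0"
  shows "frob i x * frob k y + frob k x * frob i y \<noteq> 0"
proof
  assume eq: "frob i x * frob k y + frob k x * frob i y = 0"
  have "inj (\<lambda>x. frob i (x + y) * frob k (x + y) - frob i x * frob k x)"
    using assms by (simp add: planar_def bij_is_inj)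
  moreover have "frob i (x + y) * frob k (x + y) - frob i x * frob k x
      = frob i (0 + y) * frob k (0 + y) - frob i 0 * frob k 0"
    using eq by (simp add: algebra_simps)
  ultimately have "x = 0"
    by (rule injD)
  with \<open>x \<noteq> 0\<close> show False
    by simp
qed

text \<open>For \<open>k = i + r\<close> the map \<open>x ^ (p ^ i + p ^ k)\<close> takes values in the subfield of order \<open>p ^ r\<close>.\<close>

lemma planar_frob_prod_shift_neq:
  assumes n: "n = 2 * r" and "r \<ge> 1" and pl: "planar (\<lambda>x. frob i x * frob k x)"
  shows "k \<noteq> i + r"
proof
  assume k: "k = i + r"
  have *: "frob r (frob i x * frob k x) = frob i x * frob k x" for x
    using frob_periodic[of i x] by (simp add: k n mult.commute add.assoc flip: mult_2)
  \<comment> \<open>By planarity every \<open>y\<close> is a difference of two values fixed by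
    \<open>frob r\<close>.\<close>
  have fixed: "frob r y = y" for y
  proof -
    have "surj (\<lambda>x. frob i (x + 1) * frob k (x + 1) - frob i x * frob k x)"
      using pl unfolding planar_def by (meson bij_is_surj one_neq_zero)
    from surjD[OF this, of y] obtain x
      where "y = frob i (x + 1) * frob k (x + 1) - frob i x * frob k x" ..
    then show ?thesis
      by (simp only: frob_diff *)
  qed
  have "(\<Sum>j<n. (if j = r then 1 else 0) * frob j x) = (\<Sum>j<n. (if j = 0 then 1 else 0) * frob j x)"
    for x
    using fixed[of x] n \<open>r \<ge> 1\<close> by (simp add: if_distrib[of "\<lambda>c. c * _"] cong: if_cong)
  from frob_coeff_unique[OF this, of 0] show False
    using n \<open>r \<ge> 1\<close> by simp
qed

text \<open>The polar form of \<open>f\<^sub>2\<close>, that is,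
  \<open>f\<^sub>2 (x + y) - f\<^sub>2 x - f\<^sub>2 y\<close>.\<close>

definition f2_polar :: "nat \<Rightarrow> nat \<Rightarrow> nat \<Rightarrow> 'a \<Rightarrow> 'a \<Rightarrow> 'a" where
  "f2_polar r i k x y =
     (frob i x * frob k y + frob k x * frob i y)
     + frob r (frob i x * frob k y + frob k x * frob i y)
     + 2 * (x * y - frob r (x * y))"

lemma f2_polar_add_left: "f2_polar r i k (x + y) z = f2_polar r i k x z + f2_polar r i k y z"
  by (simp add: f2_polar_def algebra_simps)

text \<open>Conjugation by \<open>frob r\<close> fixes \<open>g + frob r g\<close> and negates the
  remaining part, so both vanish and \<open>c = x * a\<close> is fixed. Substituting
  \<open>x = c / a\<close> turns \<open>g + frob r g\<close>, up to a nonzero factor, into the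
  product of the polar form of \<open>x ^ (p ^ i + p ^ k)\<close> at \<open>(frob r a, a)\<close>
  and at \<open>(c, e)\<close>, where \<open>e = a * frob r a\<close>. Planarity makes both values
  nonzero.\<close>

lemma f2_polar_nondegenerate:
  assumes n: "n = 2 * r" and "odd p" and pl: "planar (\<lambda>x. frob i x * frob k x)"
    and "a \<noteq> 0" and eq: "f2_polar r i k x a = 0"
  shows "x = 0"
proof (rule ccontr)
  assume "x \<noteq> 0"
  define g where "g = frob i x * frob k a + frob k x * frob i a"
  have conj2: "frob (j + r + r) y = frob j y" for j y
    using frob_periodic[of j y] n by (simp add: add.assoc mult_2)
  note conj2_0 = conj2[of 0, simplified]
  have eq0: "g + frob r g + 2 * (x * a - frob r (x * a)) = 0"
    using eq by (simp only: f2_polar_def g_def)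
  have "frob r (g + frob r g + 2 * (x * a - frob r (x * a))) = 0"
    unfolding eq0 by simp
  then have eq1: "g + frob r g - 2 * (x * a - frob r (x * a)) = 0"
    by (simp add: conj2_0 algebra_simps)
  have "2 * (g + frob r g) = (g + frob r g + 2 * (x * a - frob r (x * a)))
      + (g + frob r g - 2 * (x * a - frob r (x * a)))"
    by simp
  then have "2 * (g + frob r g) = 0"
    unfolding eq0 eq1 by simp
  then have g: "g + frob r g = 0"
    using two_neq_0[OF \<open>odd p\<close>] by (simp only: mult_eq_0_iff) simp
  have c: "frob r (x * a) = x * a"
    using eq0 two_neq_0[OF \<open>odd p\<close>] by (simp only: g add_0 mult_eq_0_iff) (simp del: frob_mult)
  define c where "c = x * a"
  define e where "e = a * frob r a"
  have frob_c: "frob (r + j) x * frob (r + j) a = frob j c" "frob j x * frob j a = frob j c" for j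
    using arg_cong[OF c, of "frob j"] by (simp_all add: c_def)
  \<comment> \<open>The factorization with denominators cleared: \<open>u\<close>, \<open>v\<close>
    are the \<open>i\<close>-th and \<open>k\<close>-th Frobenius images of \<open>x\<close>, and
    \<open>a\<close>, \<open>k\<close> those of \<open>a\<close>; the suffix 2 marks
    conjugates.\<close>
  have ring_id: "(u1 * k1 + v1 * a1 + (u2 * k2 + v2 * a2)) * ((a1 * a2) * (k1 * k2))
      = (a2 * k1 + k2 * a1) * (c1 * (k1 * k2) + d1 * (a1 * a2))"
    if c1: "u1 * a1 = c1" "u2 * a2 = c1" and d1: "v1 * k1 = d1" "v2 * k2 = d1"
    for a1 a2 k1 k2 u1 u2 v1 v2 c1 d1 :: 'a
  proof -
    have "(u1 * k1 + v1 * a1 + (u2 * k2 + v2 * a2)) * ((a1 * a2) * (k1 * k2))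
        = (u1 * a1) * (a2 * k1 * k1 * k2) + (v1 * k1) * (a1 * a1 * a2 * k2)
          + (u2 * a2) * (a1 * k1 * k2 * k2) + (v2 * k2) * (a1 * a2 * a2 * k1)"
      by (simp add: algebra_simps)
    then show ?thesis
      unfolding c1 d1 by (simp add: algebra_simps)
  qed
  have gexp: "(g + frob r g) * (frob i e * frob k e)
    = (frob i (frob r a) * frob k a + frob k (frob r a) * frob i a) * (frob i c * frob k e + frob k c * frob i e)"
    using ring_id[OF frob_c(2)[of i] frob_c(1)[of i] frob_c(2)[of k] frob_c(1)[of k]]
    by (simp only: g_def e_def frob_add frob_mult frob_frob add.commute[of _ r])
  have nz: "c \<noteq> 0" "e \<noteq> 0"
    using \<open>x \<noteq> 0\<close> \<open>a \<noteq> 0\<close> by (simp_all add: c_def e_def)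
  have "frob i (frob r a) * frob k a + frob k (frob r a) * frob i a \<noteq> 0"
    using \<open>a \<noteq> 0\<close> by (intro planar_frob_prod_nondegenerate[OF pl]) simp_all
  moreover have "frob i c * frob k e + frob k c * frob i e \<noteq> 0"
    using nz by (intro planar_frob_prod_nondegenerate[OF pl])
  ultimately have "(g + frob r g) * (frob i e * frob k e) \<noteq> 0"
    unfolding gexp by simp
  with g show False
    by simp
qed

section \<open>Comparison of coefficients\<close>

text \<open>Computing \<open>(a * frob r b) * (frob r a * b)\<close> in two ways gives
  \<open>(a * frob r b)\<^sup>2 = (a * frob r a)\<^sup>2\<close>. For \<open>a\<close> nonzero this
  means \<open>b = a\<close> or \<open>b = - a\<close>, and the norm equation becomes
  \<open>2 * (a * frob r a) = 0\<close>.\<close>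

lemma conj_pair_eq_0:
  assumes "odd p"
    and norm: "a * frob r a + b * frob r b = 0" and skew: "a * frob r b + frob r a * b = 0"
  shows "a = 0 \<and> b = 0"
proof -
  have "a = 0"
  proof (rule ccontr)
    assume "a \<noteq> 0"
    have ne: "frob r a \<noteq> 0"
      using \<open>a \<noteq> 0\<close> by simp
    have "(a * frob r b) * (frob r a * b) = (a * frob r a) * (b * frob r b)"
      by (simp add: algebra_simps)
    moreover have "frob r a * b = - (a * frob r b)" "b * frob r b = - (a * frob r a)"
      using norm skew by (simp_all add: eq_neg_iff_add_eq_0 add.commute)
    ultimately have "(a * frob r b)\<^sup>2 = (a * frob r a)\<^sup>2"
      by (simp add: power2_eq_square)
    then have "a * frob r b = a * frob r a \<or> a * frob r b = a * frob r (- a)"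
      by (simp add: power2_eq_iff)
    then have "frob r b = frob r a \<or> frob r b = frob r (- a)"
      using \<open>a \<noteq> 0\<close> by (simp only: mult_cancel_left) simp
    then have "b = a \<or> b = - a"
      by (simp only: frob_inject)
    then have "2 * (a * frob r a) = 0"
      using norm by auto
    then show False
      using two_neq_0[OF \<open>odd p\<close>] \<open>a \<noteq> 0\<close> ne by simp
  qed
  with norm show ?thesis
    by simp
qed

text \<open>The indices \<open>u\<close>, \<open>v\<close>, \<open>w\<close> may exceed
  \<open>n\<close> or coincide modulo \<open>n\<close>; coinciding terms add up.\<close>

lemma frob_coeff_three_terms:
  assumes eq: "\<And>y. (\<Sum>l<n. c l * frob l y) = A * frob u y + B * frob v y + D * frob w y" and "l < n"
  shows "c l = (if u mod n = l then A else 0) + (if v mod n = l then B else 0)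
    + (if w mod n = l then D else 0)"
proof (rule frob_coeff_unique[OF _ \<open>l < n\<close>])
  fix y
  have pick: "(\<Sum>l<n. (if u mod n = l then A else 0) * frob l y) = A * frob u y" for u A
  proof -
    have "(\<Sum>l<n. (if u mod n = l then A else 0) * frob l y)
        = (\<Sum>l<n. if u mod n = l then A * frob l y else 0)"
      by (intro sum.cong) auto
    also have "\<dots> = A * frob (u mod n) y"
      using \<open>l < n\<close> by simp
    finally show ?thesis
      by (simp add: frob_mod)
  qed
  show "(\<Sum>l<n. c l * frob l y) = (\<Sum>l<n. ((if u mod n = l then A else 0) +
      (if v mod n = l then B else 0) + (if w mod n = l then D else 0)) * frob l y)"
    unfolding eq distrib_right sum.distrib pick ..
qed

lemma conj_form_eq_f2_polar_imp_zero:
  fixes M W :: "'a \<Rightarrow> 'a"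
  assumes n: "n = 2 * r" and "odd p" and ik: "i < k" "k < n" "k \<noteq> i + r"
    and M: "additive M" and W: "additive W"
    and eq: "\<And>x y. 2 * (M x * frob r (M y) + frob r (M x) * M y) = W (f2_polar r i k x y)"
  shows "M x = 0"
proof -
  have "r > 0"
    using ik n by simp
  obtain m where m_per: "\<And>j. m (j + n) = m j" and M_eq: "\<And>x. M x = (\<Sum>j<n. m j * frob j x)"
    using additive_eq_frob_sum[OF M] by blast
  obtain w where w_per: "\<And>j. w (j + n) = w j" and W_eq: "\<And>x. W x = (\<Sum>j<n. w j * frob j x)"
    using additive_eq_frob_sum[OF W] by blast
  have rr: "j + r + r = j + n" for j
    by (simp add: n)
  \<comment> \<open>\<open>\<nu>\<close> lists the coefficients of \<open>frob r (M x)\<close>.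
    Since precomposing \<open>W\<close> with \<open>frob r\<close> shifts its coefficients by
    \<open>r\<close>, \<open>W\<close> acts on \<open>g + frob r g\<close> through
    \<open>\<alpha>\<close> and on \<open>2 * (x * y - frob r (x * y))\<close> through
    \<open>\<delta>\<close>.\<close>
  define \<nu> where "\<nu> j = frob r (m (j + r))" for j
  define \<alpha> where "\<alpha> j = w j + w (j + r)" for j
  define \<delta> where "\<delta> j = 2 * (w j - w (j + r))" for j
  have per2: "m (j + n + c) = m (j + c)" "w (j + n + c) = w (j + c)" for j c
    using m_per[of "j + c"] w_per[of "j + c"] by (simp_all add: add_ac)
  have fper2: "frob (j + n + c) y = frob (j + c) y" for j c y
    using frob_periodic[of "j + c" y] by (simp add: add_ac)
  have \<alpha>_per: "\<alpha> (j + n) = \<alpha> j" for j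
    by (simp add: \<alpha>_def w_per per2)
  have \<alpha>_per2: "\<alpha> (j + n + c) = \<alpha> (j + c)" for j c
    using \<alpha>_per[of "j + c"] by (simp add: add_ac)
  have \<delta>_r: "\<delta> (j + r) = - \<delta> j" for j
    using w_per[of j] by (simp add: \<delta>_def rr)
  have M_bar: "frob r (M x) = (\<Sum>j<n. \<nu> j * frob j x)" for x
  proof -
    have "(\<Sum>j<n. \<nu> (j + r) * frob (j + r) x) = (\<Sum>j<n. \<nu> j * frob j x)"
      by (rule sum_periodic_shift) (simp add: \<nu>_def per2)
    moreover have "\<nu> (j + r) = frob r (m j)" for j
      by (simp add: \<nu>_def rr m_per)
    ultimately show ?thesis
      by (simp add: M_eq)
  qed
  have W_conj: "W (frob r z) = (\<Sum>j<n. w (j + r) * frob j z)" for z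
  proof -
    have "(\<Sum>j<n. w (j + r + r) * frob (j + r) z) = (\<Sum>j<n. w (j + r) * frob j z)"
      by (rule sum_periodic_shift[where f = "\<lambda>j. w (j + r) * frob j z"]) (simp add: per2)
    then show ?thesis
      by (simp add: W_eq rr w_per add.commute[of r])
  qed
  \<comment> \<open>Each sum is shifted until \<open>x\<close> enters as \<open>frob j x\<close>;
    \<open>n - i\<close> and \<open>n - k\<close> serve as the negative shifts.\<close>
  have W_polar: "W (f2_polar r i k x y) = (\<Sum>j<n. \<alpha> (j + (n - i)) * frob (j + (n - i) + k) y * frob j x)
      + (\<Sum>j<n. \<alpha> (j + (n - k)) * frob (j + (n - k) + i) y * frob j x)
      + (\<Sum>j<n. \<delta> j * frob j y * frob j x)" for x y
  proof -
    define g where "g = frob i x * frob k y + frob k x * frob i y"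
    have shift: "(\<Sum>j<n. \<alpha> j * frob (j + v) y * frob (j + u) x)
        = (\<Sum>j<n. \<alpha> (j + (n - u)) * frob (j + (n - u) + v) y * frob j x)" if "u < n" for u v
    proof -
      have "(\<Sum>j<n. \<alpha> (j + u + (n - u)) * frob (j + u + (n - u) + v) y * frob (j + u) x)
          = (\<Sum>j<n. \<alpha> (j + (n - u)) * frob (j + (n - u) + v) y * frob j x)"
        by (rule sum_periodic_shift[where f = "\<lambda>j. \<alpha> (j + (n - u)) * frob (j + (n - u) + v) y * frob j x"])
           (use \<alpha>_per2 fper2 in \<open>simp add: add.assoc[of _ "n - u"]\<close>)
      moreover have "j + u + (n - u) = j + n" for j
        using that by simp
      ultimately show ?thesis
        by (simp add: \<alpha>_per fper2)
    qed
    have two: "2 * W z = W (2 * z)" for z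
      using additive.add[OF W, of z z] by simp
    have "f2_polar r i k x y = (g + frob r g) + 2 * (x * y - frob r (x * y))"
      by (simp only: f2_polar_def g_def)
    then have "W (f2_polar r i k x y) = W g + W (frob r g) + 2 * (W (x * y) - W (frob r (x * y)))"
      by (simp only: additive.add[OF W] additive.diff[OF W] two[symmetric])
    also have "\<dots> = (\<Sum>j<n. \<alpha> j * frob j g + \<delta> j * frob j (x * y))"
      unfolding W_conj W_eq[of g] W_eq[of "x * y"]
      by (simp add: \<alpha>_def \<delta>_def algebra_simps sum.distrib sum_subtractf sum_distrib_left del: frob_mult)
    also have "\<dots> = (\<Sum>j<n. \<alpha> j * frob (j + k) y * frob (j + i) x
        + \<alpha> j * frob (j + i) y * frob (j + k) x + \<delta> j * frob j y * frob j x)"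
      by (intro sum.cong) (simp_all add: g_def algebra_simps)
    finally show ?thesis
      using ik by (simp add: sum.distrib shift)
  qed
  \<comment> \<open>The coefficient of \<open>frob j x * frob l y\<close>, found by comparing first
    in \<open>x\<close> for fixed \<open>y\<close>, then in \<open>y\<close>.\<close>
  have coeffs: "2 * (m j * \<nu> l + \<nu> j * m l) = (if (j + (n - i) + k) mod n = l then \<alpha> (j + (n - i)) else 0)
      + (if (j + (n - k) + i) mod n = l then \<alpha> (j + (n - k)) else 0)
      + (if j mod n = l then \<delta> j else 0)" if "j < n" "l < n" for j l
  proof (rule frob_coeff_three_terms[OF _ \<open>l < n\<close>])
    fix y
    have "2 * (m j * frob r (M y) + \<nu> j * M y) = \<alpha> (j + (n - i)) * frob (j + (n - i) + k) y
        + \<alpha> (j + (n - k)) * frob (j + (n - k) + i) y + \<delta> j * frob j y"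
    proof (rule frob_coeff_unique[OF _ \<open>j < n\<close>])
      fix x
      have "(\<Sum>j<n. 2 * (m j * frob r (M y) + \<nu> j * M y) * frob j x)
          = 2 * (M x * frob r (M y) + frob r (M x) * M y)"
        unfolding M_bar[of x] unfolding M_eq[of x]
        by (simp add: sum_distrib_left sum_distrib_right sum.distrib distrib_left distrib_right mult_ac)
      also have "\<dots> = (\<Sum>j<n. (\<alpha> (j + (n - i)) * frob (j + (n - i) + k) y
        + \<alpha> (j + (n - k)) * frob (j + (n - k) + i) y + \<delta> j * frob j y) * frob j x)"
        unfolding eq W_polar by (simp add: sum.distrib distrib_right)
      finally show "(\<Sum>j<n. 2 * (m j * frob r (M y) + \<nu> j * M y) * frob j x)
          = (\<Sum>j<n. (\<alpha> (j + (n - i)) * frob (j + (n - i) + k) y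
        + \<alpha> (j + (n - k)) * frob (j + (n - k) + i) y + \<delta> j * frob j y) * frob j x)" .
    qed
    then show "(\<Sum>l<n. 2 * (m j * \<nu> l + \<nu> j * m l) * frob l y) = \<alpha> (j + (n - i)) * frob (j + (n - i) + k) y
        + \<alpha> (j + (n - k)) * frob (j + (n - k) + i) y + \<delta> j * frob j y"
      unfolding M_bar[of y] unfolding M_eq[of y]
      by (simp add: sum_distrib_left sum_distrib_right sum.distrib distrib_left distrib_right mult_ac)
  qed
  \<comment> \<open>Modulo \<open>n\<close> the offsets are \<open>k - i\<close> and its negative.
    Neither is 0, so only \<open>\<delta>\<close> remains at \<open>l = j\<close>.\<close>
  have diag: "2 * (m j * \<nu> j + \<nu> j * m j) = \<delta> j" if "j < n" for j
  proof -
    have "(j + (n - i + k)) mod n \<noteq> (j + 0) mod n" "(j + (n - k + i)) mod n \<noteq> (j + 0) mod n"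
      by (rule mod_add_neq; use ik in linarith)+
    with coeffs[OF that that] that show ?thesis
      by (simp add: add.assoc)
  qed
  have m_eq_0: "m j = 0 \<and> m (j + r) = 0" if "j < r" for j
  proof (rule conj_pair_eq_0[OF \<open>odd p\<close>])
    have j: "j < n" "j + r < n"
      using that n by auto
    have \<nu>_r: "\<nu> (j + r) = frob r (m j)"
      by (simp add: \<nu>_def rr m_per)
    \<comment> \<open>None of the three offsets is \<open>r\<close> modulo \<open>n\<close>, so the
      coefficient at \<open>l = j + r\<close> is zero.\<close>
    have "(j + (n - i + k)) mod n \<noteq> (j + r) mod n" "(j + (n - k + i)) mod n \<noteq> (j + r) mod n"
      "(j + 0) mod n \<noteq> (j + r) mod n"
      by (rule mod_add_neq; use ik n \<open>r > 0\<close> in linarith)+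
    with coeffs[OF j] j have "2 * (m j * \<nu> (j + r) + \<nu> j * m (j + r)) = 0"
      by (simp add: add.assoc)
    then have "m j * \<nu> (j + r) + \<nu> j * m (j + r) = 0"
      using two_neq_0[OF \<open>odd p\<close>] by (simp only: mult_eq_0_iff) simp
    then show "m j * frob r (m j) + m (j + r) * frob r (m (j + r)) = 0"
      unfolding \<nu>_r by (simp add: \<nu>_def mult.commute)
    \<comment> \<open>The diagonal coefficients at \<open>j\<close> and \<open>j + r\<close> are
      \<open>\<delta> j\<close> and \<open>- \<delta> j\<close>.\<close>
    have "2 * (2 * (m j * \<nu> j + m (j + r) * \<nu> (j + r))) = 0"
      using diag[OF j(1)] diag[OF j(2)] by (simp add: \<delta>_r algebra_simps)
    then have "m j * \<nu> j + m (j + r) * \<nu> (j + r) = 0"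
      using two_neq_0[OF \<open>odd p\<close>] by (simp only: mult_eq_0_iff) simp
    then show "m j * frob r (m (j + r)) + frob r (m j) * m (j + r) = 0"
      unfolding \<nu>_r by (simp add: \<nu>_def mult.commute)
  qed
  have "m j = 0" if "j < n" for j
    using m_eq_0[of j] m_eq_0[of "j - r"] that n by (cases "j < r") auto
  then show ?thesis
    by (simp add: M_eq)
qed

section \<open>Polar forms of generalized Budaghyan-Helleseth functions and the shape of CCZ
  equivalences\<close>

text \<open>The last two terms of \<open>B\<close> are \<open>\<omega>\<close> times a sum of an
  element and its conjugate. That sum is fixed by \<open>frob r\<close> while
  \<open>\<omega>\<close> is negated, so these terms cancel against their conjugates.\<close>

lemma generalized_BH_polar:
  fixes B :: "'a \<Rightarrow> 'a"
  assumes n: "n = 2 * r" and "generalized_BH p r B"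
  obtains G :: "'a \<Rightarrow> 'a \<Rightarrow> 'a" where
    "\<And>u v. B (u + v) = B u + B v + G u v"
    "\<And>u v w. G (u + v) w = G u w + G v w"
    "\<And>u v. G u v + frob r (G u v) = 2 * (u * frob r v + frob r u * v)"
proof -
  obtain s \<omega> \<beta> where \<omega>: "\<omega> + \<omega> ^ (p ^ r) = 0"
    and B: "B = (\<lambda>x. x ^ (p ^ r + 1) + \<omega> * \<beta> * x ^ (p ^ s + 1)
                  + \<omega> * \<beta> ^ (p ^ r) * x ^ ((p ^ s + 1) * p ^ r))"
    using assms(2) unfolding generalized_BH_def by blast
  have \<omega>': "frob r \<omega> = - \<omega>"
    using \<omega> by (simp add: frob_def eq_neg_iff_add_eq_0 add.commute)
  have B_eq: "B x = x * frob r x + \<omega> * (\<beta> * (x * frob s x) + frob r (\<beta> * (x * frob s x)))" for x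
    unfolding B by (simp only: frob_def power_mult power_mult_distrib distrib_left power_add
        power_one_right mult_ac add.assoc power_commutes)
      (simp add: mult.commute flip: power_mult)
  define T where "T u v = \<beta> * (u * frob s v + frob s u * v)" for u v
  define G where "G u v = u * frob r v + frob r u * v + \<omega> * (T u v + frob r (T u v))" for u v
  have conj2: "frob (j + r + r) y = frob j y" for j y
    using frob_periodic[of j y] n by (simp add: add.assoc mult_2)
  note conj2_0 = conj2[of 0, simplified]
  show thesis
  proof
    show "B (u + v) = B u + B v + G u v" for u v
      by (simp add: B_eq G_def T_def algebra_simps)
    show "G (u + v) w = G u w + G v w" for u v w
      by (simp add: G_def T_def algebra_simps)
    have "frob r (G u v) = u * frob r v + frob r u * v - \<omega> * (T u v + frob r (T u v))" for u v
      by (simp add: G_def conj2_0 \<omega>' algebra_simps)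
    then show "G u v + frob r (G u v) = 2 * (u * frob r v + frob r u * v)" for u v
      by (simp add: G_def)
  qed
qed

end

text \<open>Injectivity of \<open>x \<mapsto> fst (L (x, f x))\<close> already forces \<open>L\<close> to be block triangular: for \<open>a \<noteq> 0\<close> the
  differences \<open>f (x + a) - f x\<close> exhaust the field, so \<open>- fst (L (a, 0))\<close> is never of the form
  \<open>fst (L (0, y))\<close>.\<close>

lemma CCZ_equivalent_polar:
  fixes f B :: "'a::{field,finite} \<Rightarrow> 'a"
  assumes "CCZ_equivalent f B"
    and f: "\<And>x y. f (x + y) = f x + f y + Fp x y"
    and Fp: "\<And>x y z. Fp (x + y) z = Fp x z + Fp y z"
      "\<forall>x a. a \<noteq> 0 \<longrightarrow> Fp x a = 0 \<longrightarrow> x = 0"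
    and B: "\<And>u v. B (u + v) = B u + B v + G u v"
    and G: "\<And>u v w. G (u + v) w = G u w + G v w"
  obtains M N where "additive M" "inj M" "additive N" "\<And>x y. G (M x) (M y) = N (Fp x y)"
proof -
  obtain L b where L: "prime_field_linear L" and bij: "bij (\<lambda>v. L v + b)"
    and graph: "(\<lambda>v. L v + b) ` graph_of f = graph_of B"
    using assms(1) unfolding CCZ_equivalent_def affine_perm_def by blast
  have L_add: "L (u + v) = L u + L v" for u v
    using L unfolding prime_field_linear_def by blast
  define M where "M x = fst (L (x, 0))" for x
  define E where "E y = fst (L (0, y))" for y
  define K where "K x = snd (L (x, 0))" for x
  define N where "N y = snd (L (0, y))" for y
  have L_eq: "L (x, y) = (M x + E y, K x + N y)" for x y
    using L_add[of "(x, 0)" "(0, y)"] by (simp add: M_def E_def K_def N_def prod_eq_iff)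
  have addM: "additive M" and addE: "additive E" and addK: "additive K" and addN: "additive N"
    using L_add[of "(_, 0)" "(_, 0)"] L_add[of "(0, _)" "(0, _)"]
    by (simp_all add: additive_def M_def E_def K_def N_def)
  have graph_eq: "B (M x + E (f x) + fst b) = K x + N (f x) + snd b" for x
  proof -
    have "L (x, f x) + b \<in> graph_of B"
      using graph by (auto simp: graph_of_def)
    then show ?thesis
      by (auto simp: graph_of_def L_eq prod_eq_iff)
  qed
  \<comment> \<open>On the graph of \<open>B\<close> the first coordinate determines the
    second.\<close>
  have inj: "x = y" if "M x + E (f x) = M y + E (f y)" for x y
  proof -
    have "K x + N (f x) = K y + N (f y)"
      using graph_eq[of x] graph_eq[of y] that by simp
    then have "L (x, f x) + b = L (y, f y) + b"
      using that by (simp add: L_eq)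
    then show ?thesis
      using injD[OF bij_is_inj[OF bij], of "(x, f x)" "(y, f y)"] by simp
  qed
  have M_E: "M a + E y \<noteq> 0" if "a \<noteq> 0" for a y
  proof
    assume 0: "M a + E y = 0"
    have "inj (\<lambda>x. Fp x a)"
    proof (rule injI)
      fix x y assume "Fp x a = Fp y a"
      then have "Fp (x - y) a = 0"
        using Fp(1)[of "x - y" y a] by simp
      then have "x - y = 0"
        using Fp(2) that by blast
      then show "x = y"
        by simp
    qed
    then have "surj (\<lambda>x. Fp x a)"
      by (simp add: finite_UNIV_inj_surj)
    \<comment> \<open>This \<open>x\<close> satisfies \<open>f (x + a) - f x = y\<close>, so the
      graph points over \<open>x\<close> and \<open>x + a\<close> get the same first image
      coordinate.\<close>
    then obtain x where "y - f a = Fp x a"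
      by (metis surjD)
    then have "f (x + a) = f x + y"
      using f[of x a] by (simp add: algebra_simps)
    then have "M (x + a) + E (f (x + a)) = M x + E (f x)"
      using 0 by (simp add: additive.add[OF addM] additive.add[OF addE] add_ac)
    then have "x + a = x"
      by (rule inj)
    with that show False
      by simp
  qed
  have injM: "inj M"
  proof (rule injI)
    fix x y assume "M x = M y"
    then have "M (x - y) + E 0 = 0"
      by (simp add: additive.diff[OF addM] additive.zero[OF addE])
    then show "x = y"
      using M_E[of "x - y" 0] by auto
  qed
  then have "surj M"
    by (simp add: finite_UNIV_inj_surj)
  have E0: "E y = 0" for y
  proof -
    obtain a where a: "- E y = M a"
      using \<open>surj M\<close> by (metis surjD)
    then have "M a + E y = 0"
      by (simp flip: a)
    then have "a = 0"
      using M_E by blast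
    then show ?thesis
      using a by (simp add: additive.zero[OF addM])
  qed
  show thesis
  proof (rule that[OF addM injM addN])
    fix x y
    have "Fp 0 0 = 0"
      using Fp(1)[of 0 0 0] by (metis add.right_neutral add_left_cancel)
    then have f0: "f 0 = 0"
      using f[of 0 0] by (metis add.right_neutral add_left_cancel)
    have G_sym: "G u v = G v u" for u v
      using B[of u v] B[of v u] by (metis add.commute add_left_cancel)
    have "M 0 = 0" "K 0 = 0" "N 0 = 0"
      using addM addK addN by (simp_all add: additive.zero)
    then have B_c: "B (fst b) = snd b"
      using graph_eq[of 0] E0 f0 by simp
    have B_M: "B (M z + fst b) = K z + N (f z) + snd b" for z
      using graph_eq[of z] E0 by simp
    \<comment> \<open>The second difference of \<open>B\<close> based at \<open>fst b\<close> is
      \<open>G (M y) (M x)\<close>; on the image of the graph of \<open>f\<close>, \<open>K\<close>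
      and the constants cancel and \<open>N (Fp x y)\<close> is left.\<close>
    have "B (M x + (M y + fst b)) = B (M x) + B (M y + fst b) + (G (M y) (M x) + G (fst b) (M x))"
      unfolding B[of "M x" "M y + fst b"] G_sym[of "M x"] G ..
    moreover have "B (M x + fst b) = B (M x) + B (fst b) + G (fst b) (M x)"
      unfolding B[of "M x" "fst b"] G_sym[of "M x"] ..
    ultimately have
      "G (M y) (M x) = B (M x + (M y + fst b)) - B (M x + fst b) - B (M y + fst b) + B (fst b)"
      by simp
    also have "M x + (M y + fst b) = M (x + y) + fst b"
      by (simp add: additive.add[OF addM] add.assoc)
    also have "B \<dots> = K x + K y + N (f x) + N (f y) + N (Fp x y) + snd b"
      unfolding B_M f by (simp add: additive.add[OF addK] additive.add[OF addN] add_ac)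
    finally have "G (M y) (M x) = N (Fp x y)"
      by (simp add: B_M B_c)
    then show "G (M x) (M y) = N (Fp x y)"
      by (rule trans[OF G_sym])
  qed
qed

theorem theorem6:
  fixes p r i k :: nat
    and h f\<^sub>2 :: "'a::{field,finite} \<Rightarrow> 'a"
  assumes "prime p" and "odd p" and "r \<ge> 1"
    and "CARD('a) = p ^ (2 * r)"
    and "i < k" and "k < 2 * r"
  defines "h \<equiv> (\<lambda>x. x ^ (p ^ i + p ^ k))"
  assumes "planar h"
  defines "f\<^sub>2 \<equiv> (\<lambda>x. h x + h x ^ (p ^ r) + x ^ 2 - x ^ (2 * p ^ r))"
  shows "\<forall>B :: 'a \<Rightarrow> 'a. generalized_BH p r B \<longrightarrow> \<not> CCZ_equivalent f\<^sub>2 B"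
proof (intro allI impI notI)
  fix B :: "'a \<Rightarrow> 'a"
  assume BH: "generalized_BH p r B" and CCZ: "CCZ_equivalent f\<^sub>2 B"
  interpret finite_field_order p "2 * r" "TYPE('a)"
    by unfold_locales fact+
  have h_eq: "h = (\<lambda>x. frob i x * frob k x)"
    by (simp add: h_def frob_def power_add)
  have pl: "planar (\<lambda>x. frob i x * frob k x)"
    using \<open>planar h\<close> by (simp only: h_eq)
  have f2_eq: "f\<^sub>2 x = frob i x * frob k x + frob r (frob i x * frob k x) + x * x - frob r (x * x)" for x
    unfolding f\<^sub>2_def h_eq by (simp add: frob_def power2_eq_square power_mult)
  have f2: "f\<^sub>2 (x + y) = f\<^sub>2 x + f\<^sub>2 y + f2_polar r i k x y" for x y
    unfolding f2_eq f2_polar_def by (simp add: algebra_simps)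
  have nondeg: "\<forall>x a. a \<noteq> 0 \<longrightarrow> f2_polar r i k x a = 0 \<longrightarrow> x = 0"
    using f2_polar_nondegenerate[OF refl \<open>odd p\<close> pl] by blast
  obtain G where G: "\<And>u v. B (u + v) = B u + B v + G u v" "\<And>u v w. G (u + v) w = G u w + G v w"
      "\<And>u v. G u v + frob r (G u v) = 2 * (u * frob r v + frob r u * v)"
    using generalized_BH_polar[OF refl BH] by blast
  obtain M N where M: "additive M" "inj M" and N: "additive N"
    and MN: "\<And>x y. G (M x) (M y) = N (f2_polar r i k x y)"
    using CCZ_equivalent_polar[OF CCZ f2 f2_polar_add_left nondeg G(1,2)] by blast
  define W where "W y = N y + frob r (N y)" for y
  have "additive W"
    using N by (simp add: additive_def W_def)
  moreover have "2 * (M x * frob r (M y) + frob r (M x) * M y) = W (f2_polar r i k x y)" for x y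
    using G(3)[of "M x" "M y"] by (simp only: W_def MN)
  ultimately have "M 1 = 0"
    using conj_form_eq_f2_polar_imp_zero[OF refl \<open>odd p\<close> \<open>i < k\<close> \<open>k < 2 * r\<close>
        planar_frob_prod_shift_neq[OF refl \<open>r \<ge> 1\<close> pl] M(1)] by blast
  also have "0 = M 0"
    using M(1) by (simp add: additive.zero)
  finally have "(1::'a) = 0"
    by (rule injD[OF M(2)])
  then show False
    by simp
qed

end
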